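(* Let $(b_n)_{n\ge0}$ and $(a_n^2)_{n\ge1}$ be sequences with $a_n^2\neq0$, let $(P_n)$ be the corresponding monic orthogonal polynomials and $(P_n^{(1)})$ their associated polynomials of order $1$. Let $r\ge1$ be an integer, let $b_{-r},\dots,b_{-1}$ and $a_{-r+1}^2,\dots,a_{-1}^2,a_0^2\neq0$ be $2r$ new parameters, let $P_n^{(-r)}$ ($n\ge0$) be the corresponding monic anti-associated polynomials of order $r$, and let $Q_0,\dots,Q_r$ be the monic polynomials determined by the new parameters (all as defined in the context). Then $$P_{n+r}^{(-r)}(x)=Q_r(x)\,P_n(x)-a_0^2\,Q_{r-1}(x)\,P_{n-1}^{(1)}(x),\qquad n\ge0 .$$
   Context: The monic polynomials $P_n$ are defined by $P_{n+1}(x)=(x-b_n)P_n(x)-a_n^2P_{n-1}(x)$, $n\ge0$, with $P_{-1}=0$, $P_0=1$. The associated polynomials of order $1$ are defined by $P_{n+1}^{(1)}(x)=(x-b_{n+1})P_n^{(1)}(x)-a_{n+1}^2P_{n-1}^{(1)}(x)$, $n\ge0$, with $P_{-1}^{(1)}=0$, $P_0^{(1)}=1$. The monic anti-associated polynomials of order $r$ are defined by $$P_{n+1}^{(-r)}(x)=(x-b_{n-r})P_n^{(-r)}(x)-a_{n-r}^2P_{n-1}^{(-r)}(x),\quad n\ge0,\qquad P_0^{(-r)}=1,\ P_{-1}^{(-r)}=0$$ (the value of $a_{-r}^2$ is irrelevant), i.e. they correspond to the Jacobi matrix with diagonal $b_{-r},\dots,b_{-1},b_0,b_1,\dots$, lower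 subdiagonal $a_{-r+1}^2,\dots,a_0^2,a_1^2,a_2^2,\dots$ and upper subdiagonal identically $1$. The polynomials $Q_n$ are defined by $Q_0=1$, $Q_{-1}=0$, $Q_{n+1}(x)=(x-b_{-r+n})Q_n(x)-a_{-r+n}^2Q_{n-1}(x)$ for $0\le n\le r-1$. *)

theory Defs
  imports "HOL-Computational_Algebra.Polynomial"
begin

text \<open>
  The indices are integers, so that the paper's convention of giving polynomials the index \<open>-1\<close>
  (with value \<open>0\<close>) and the new parameters negative indices is kept literally.  The argument
  \<open>asq k\<close> stands for \<open>a\<^sub>k\<^sup>2\<close>: only this value enters, and it need not be a square in the field.
  The coefficient \<open>asq 0\<close> in the step from index \<open>0\<close> to \<open>1\<close> is multiplied by the polynomial of
  index \<open>-1\<close>, so its value is irrelevant.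
\<close>

function rec_poly :: "(int \<Rightarrow> 'a::field) \<Rightarrow> (int \<Rightarrow> 'a) \<Rightarrow> int \<Rightarrow> 'a poly" where
  "rec_poly b asq n =
    (if n < 0 then 0
     else if n = 0 then 1
     else [:- b (n - 1), 1:] * rec_poly b asq (n - 1)
            - smult (asq (n - 1)) (rec_poly b asq (n - 2)))"
  by pat_completeness auto
termination
  by (relation "measure (\<lambda>(b, asq, n). nat n)") auto

declare rec_poly.simps [simp del]

definition monic_poly :: "(int \<Rightarrow> 'a::field) \<Rightarrow> (int \<Rightarrow> 'a) \<Rightarrow> int \<Rightarrow> 'a poly" where
  "monic_poly b asq n = rec_poly b asq n"

definition associated_poly1 :: "(int \<Rightarrow> 'a::field) \<Rightarrow> (int \<Rightarrow> 'a) \<Rightarrow> int \<Rightarrow> 'a poly" where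
  "associated_poly1 b asq n = rec_poly (\<lambda>k. b (k + 1)) (\<lambda>k. asq (k + 1)) n"

definition anti_associated_poly ::
    "(int \<Rightarrow> 'a::field) \<Rightarrow> (int \<Rightarrow> 'a) \<Rightarrow> nat \<Rightarrow> int \<Rightarrow> 'a poly" where
  "anti_associated_poly b asq r n = rec_poly (\<lambda>k. b (k - int r)) (\<lambda>k. asq (k - int r)) n"

text \<open>
  The polynomials \<open>Q\<^sub>n\<close> are meant only for \<open>n \<le> r\<close>; in that range they involve \<open>b k\<close> and \<open>asq k\<close>
  for negative \<open>k\<close> only.
\<close>

definition Q_poly :: "(int \<Rightarrow> 'a::field) \<Rightarrow> (int \<Rightarrow> 'a) \<Rightarrow> nat \<Rightarrow> int \<Rightarrow> 'a poly" where
  "Q_poly b asq r n = rec_poly (\<lambda>k. b (- int r + k)) (\<lambda>k. asq (- int r + k)) n"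

lemma monic_poly_rec:
  "monic_poly b asq (-1) = 0"
  "monic_poly b asq 0 = 1"
  "n \<ge> 0 \<Longrightarrow> monic_poly b asq (n + 1) =
     [:- b n, 1:] * monic_poly b asq n - smult (asq n) (monic_poly b asq (n - 1))"
  unfolding monic_poly_def by (subst rec_poly.simps, simp)+

lemma associated_poly1_rec:
  "associated_poly1 b asq (-1) = 0"
  "associated_poly1 b asq 0 = 1"
  "n \<ge> 0 \<Longrightarrow> associated_poly1 b asq (n + 1) =
     [:- b (n + 1), 1:] * associated_poly1 b asq n
       - smult (asq (n + 1)) (associated_poly1 b asq (n - 1))"
  unfolding associated_poly1_def by (subst rec_poly.simps, simp)+

lemma anti_associated_poly_rec:
  "anti_associated_poly b asq r (-1) = 0"
  "anti_associated_poly b asq r 0 = 1"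
  "n \<ge> 0 \<Longrightarrow> anti_associated_poly b asq r (n + 1) =
     [:- b (n - int r), 1:] * anti_associated_poly b asq r n
       - smult (asq (n - int r)) (anti_associated_poly b asq r (n - 1))"
  unfolding anti_associated_poly_def by (subst rec_poly.simps, simp)+

lemma Q_poly_rec:
  "Q_poly b asq r (-1) = 0"
  "Q_poly b asq r 0 = 1"
  "0 \<le> n \<Longrightarrow> n \<le> int r - 1 \<Longrightarrow> Q_poly b asq r (n + 1) =
     [:- b (- int r + n), 1:] * Q_poly b asq r n
       - smult (asq (- int r + n)) (Q_poly b asq r (n - 1))"
  unfolding Q_poly_def by (subst rec_poly.simps, simp)+

end

theory Submission
  imports Defs
begin

text \<open>
  All the polynomials come from one recurrence started at different parameter indices: the
  anti-associated polynomials and the \<open>Q\<close> both start at \<open>-r\<close>, \<open>P\<close> starts at \<open>0\<close>, and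
  \<open>P\<^sup>(\<^sup>1\<^sup>)\<close> starts at \<open>1\<close>.  The identity is therefore a statement about a single recurrence,
  cut at an index \<open>m\<close> (lemma \<open>rec_poly_split\<close>; here \<open>m = r\<close>).  From \<open>m\<close> on, the
  sequence solves a linear recurrence of second order, so it is a combination of two solutions of
  that recurrence: the one with initial values \<open>1, x - b\<^sub>m\<close>, whose coefficient is the value of
  the sequence at \<open>m\<close>, and the one with initial values \<open>0, 1\<close>, which is the family started
  one index later and whose coefficient is \<open>-a\<^sub>m\<^sup>2\<close> times the value at \<open>m - 1\<close>.
\<close>

lemma rec_poly_neg: "n < 0 \<Longrightarrow> rec_poly b a n = 0"
  by (subst rec_poly.simps) simp

lemma rec_poly_0: "rec_poly b a 0 = 1"
  by (subst rec_poly.simps) simp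

lemma rec_poly_step:
  "n > 0 \<Longrightarrow> rec_poly b a n =
     [:- b (n - 1), 1:] * rec_poly b a (n - 1) - smult (a (n - 1)) (rec_poly b a (n - 2))"
  by (subst rec_poly.simps) simp

text \<open>
  Both sides satisfy the same second-order recurrence in \<open>n\<close>, so agreement for \<open>n = 0, 1\<close> is
  enough.  The case \<open>n = 1\<close> cannot come from the inductive step: the last factor on the right
  jumps there from \<open>0\<close> to \<open>1\<close> and obeys the recurrence only afterwards.
\<close>

lemma rec_poly_split:
  fixes b a :: "int \<Rightarrow> 'a::field" and m :: int and n :: nat
  assumes "m \<ge> 0"
  shows "rec_poly b a (int n + m) =
           rec_poly b a m * rec_poly (\<lambda>k. b (k + m)) (\<lambda>k. a (k + m)) (int n)
             - smult (a m) (rec_poly b a (m - 1)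
                 * rec_poly (\<lambda>k. b (k + 1 + m)) (\<lambda>k. a (k + 1 + m)) (int n - 1))"
proof (induction n rule: induct_nat_012)
  case 0
  show ?case by (simp add: rec_poly_0 rec_poly_neg)
next
  case 1
  have "rec_poly b a (m + 1) =
          [:- b m, 1:] * rec_poly b a m - smult (a m) (rec_poly b a (m - 1))"
    using rec_poly_step[of "m + 1" b a] assms by simp
  moreover have "rec_poly (\<lambda>k. b (k + m)) (\<lambda>k. a (k + m)) 1 = [:- b m, 1:]"
    by (subst rec_poly_step) (simp_all add: rec_poly_0 rec_poly_neg)
  ultimately show ?case by (simp add: rec_poly_0 add.commute)
next
  case (ge2 n)
  define j where "j = int n + 1 + m"
  let ?u = "rec_poly (\<lambda>k. b (k + m)) (\<lambda>k. a (k + m))"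
  let ?v = "rec_poly (\<lambda>k. b (k + 1 + m)) (\<lambda>k. a (k + 1 + m))"
  have w: "rec_poly b a (int n + 2 + m) =
      [:- b j, 1:] * rec_poly b a (int n + 1 + m) - smult (a j) (rec_poly b a (int n + m))"
    using rec_poly_step[of "int n + 2 + m" b a] assms by (simp add: j_def algebra_simps)
  have u: "?u (int n + 2) = [:- b j, 1:] * ?u (int n + 1) - smult (a j) (?u (int n))"
    by (subst rec_poly_step) (simp_all add: j_def algebra_simps)
  have v: "?v (int n + 1) = [:- b j, 1:] * ?v (int n) - smult (a j) (?v (int n - 1))"
    by (subst rec_poly_step) (simp_all add: j_def algebra_simps)
  have IH1: "rec_poly b a (int n + 1 + m) =
      rec_poly b a m * ?u (int n + 1) - smult (a m) (rec_poly b a (m - 1) * ?v (int n))"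
    using ge2.IH(2) by (simp add: add.commute)
  have *: "?case \<longleftrightarrow> rec_poly b a (int n + 2 + m) =
      rec_poly b a m * ?u (int n + 2) - smult (a m) (rec_poly b a (m - 1) * ?v (int n + 1))"
    by (simp add: add.commute)
  \<comment> \<open>The polynomial \<open>X = x - b\<^sub>j\<close> is kept opaque; expanding it would split the products.\<close>
  have distrib: "X * (A * u1 - smult c (B * v1)) - smult d (A * u0 - smult c (B * v0))
      = A * (X * u1 - smult d u0) - smult c (B * (X * v1 - smult d v0))"
    for X A B u0 u1 v0 v1 :: "'a poly" and c d
    by (simp add: algebra_simps smult_diff_right)
  show ?case
    unfolding * w u v IH1 ge2.IH(1) by (rule distrib)
qed

theorem mainTheorem2:
  fixes b asq :: "int \<Rightarrow> 'a::field" and r n :: nat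
  assumes "r \<ge> 1"
    and "\<And>k. k \<ge> 1 \<Longrightarrow> asq k \<noteq> 0"
    and "\<And>k. - int r + 1 \<le> k \<Longrightarrow> k \<le> 0 \<Longrightarrow> asq k \<noteq> 0"
  shows "anti_associated_poly b asq r (int n + int r) =
           Q_poly b asq r (int r) * monic_poly b asq (int n)
             - smult (asq 0) (Q_poly b asq r (int r - 1) * associated_poly1 b asq (int n - 1))"
  using rec_poly_split[of "int r" "\<lambda>k. b (k - int r)" "\<lambda>k. asq (k - int r)" n]
  by (simp add: anti_associated_poly_def Q_poly_def monic_poly_def associated_poly1_def)

end
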